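(* There is a finite constant $C$ such that for all (measurable, integrable) functions $f_1,f_2,f_3,f_4:\mathbb{R}\to\mathbb{R}_{\ge 0}$, $$\left\| f_1(x+y)^{\frac27}\, f_2(-x+y)^{\frac27}\, f_3(y)^{\frac27}\, f_4(x+3y)^{\frac17}\right\|_{L_x^{7/4}L_y^{7/3}} \le C\, \|f_1\|_{L^1}^{\frac27}\|f_2\|_{L^1}^{\frac27}\|f_3\|_{L^1}^{\frac27}\|f_4\|_{L^1}^{\frac17}.$$
   Context: For $q,r\in(0,\infty)$ and a measurable function $F$ on $\mathbb{R}^2$ the mixed norm is $\|F\|_{L_x^qL_y^r}=\left(\int_{\mathbb{R}}\left(\int_{\mathbb{R}}|F(x,y)|^r\,dy\right)^{q/r}dx\right)^{1/q}$. Here $\|f\|_{L^1}=\int_{\mathbb{R}}|f|$. *)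

theory Defs
  imports "HOL-Analysis.Analysis"
begin

text \<open>
  The power \<open>t\<^sup>p\<close> of \<open>t \<in> [0,\<infinity>]\<close> for an exponent \<open>p > 0\<close>, with \<open>\<infinity>\<^sup>p = \<infinity>\<close> and \<open>0\<^sup>p = 0\<close>.
  It is needed because the integrals in a mixed norm may be infinite.
\<close>
definition ennpowr :: "ennreal \<Rightarrow> real \<Rightarrow> ennreal" where
  "ennpowr t p = (if t = \<infinity> then \<infinity> else ennreal (enn2real t powr p))"

text \<open>
  The mixed norm \<open>L\<^sub>x\<^sup>q L\<^sub>y\<^sup>r\<close> for finite \<open>q, r > 0\<close>, with values in \<open>[0,\<infinity>]\<close>: the inner
  integral is over the second variable (exponent \<open>r\<close>), the outer one over the first
  (exponent \<open>q\<close>).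
\<close>
definition mixed_norm :: "real \<Rightarrow> real \<Rightarrow> (real \<times> real \<Rightarrow> real) \<Rightarrow> ennreal" where
  "mixed_norm q r F =
     ennpowr (\<integral>\<^sup>+ x. ennpowr (\<integral>\<^sup>+ y. ennreal (\<bar>F (x, y)\<bar> powr r) \<partial>lebesgue) (q / r) \<partial>lebesgue) (1 / q)"

text \<open>Only meaningful for integrable \<open>f\<close>: the Bochner integral is \<open>0\<close> otherwise.\<close>
definition L1_norm :: "(real \<Rightarrow> real) \<Rightarrow> real" where
  "L1_norm f = (\<integral>x. \<bar>f x\<bar> \<partial>lebesgue)"

end

theory Submission
  imports Defs
begin

text \<open>
  After raising to the power \<open>7/4\<close>, the estimate is dual to the entropy inequality
  \<open>3 H(x, y) + H(x) \<le> 2 H(x + y) + 2 H(y - x) + 2 H(y) + H(x + 3y)\<close>, the entropy form of the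
  Katz--Tao sums-differences bound with exponent \<open>7/4\<close>. It is proved for finitely supported laws on
  the integer lattice: take two copies of \<open>(x, y)\<close> conditionally independent given \<open>y - x\<close>, and then
  two copies of this pair \<open>(P, Q)\<close> conditionally independent given \<open>(y(P), y(Q))\<close>. The resulting
  parallelogram \<open>(P, Q, P', Q')\<close> has entropy at least \<open>4 H(x, y) - 2 H(y - x) - 2 H(y)\<close>, but it is
  determined by \<open>P'\<close> and three further values, and these values already determine \<open>x(P')\<close>. Applied
  to the density extremal for the mixed norm, this gives the discrete inequality with constant \<open>1\<close>.
  The integral inequality follows by majorizing each function by step functions on grids of mesh
  tending to \<open>0\<close>, with \<open>L\<^sup>1\<close> norm at most about twice as large, and Fatou's lemma.
\<close>

section \<open>Gibbs' inequality and conditionally independent couplings\<close>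

text \<open>Sum \<open>ln t \<le> t - 1\<close> at \<open>t = r a / p a\<close> with weights
  \<open>p a\<close>. Since only total masses are compared, \<open>r\<close> may have less mass than
  \<open>p\<close>, as does the comparison weight built from the given functions later on.\<close>

lemma gibbs_inequality:
  fixes p r :: "'a \<Rightarrow> real"
  assumes "\<And>a. a \<in> A \<Longrightarrow> p a > 0" "\<And>a. a \<in> A \<Longrightarrow> r a > 0" "sum r A \<le> sum p A"
  shows "(\<Sum>a\<in>A. p a * ln (r a)) \<le> (\<Sum>a\<in>A. p a * ln (p a))"
proof -
  have "(\<Sum>a\<in>A. p a * ln (r a)) \<le> (\<Sum>a\<in>A. p a * ln (p a) + (r a - p a))"
  proof (rule sum_mono)
    fix a assume a: "a \<in> A"
    have pr: "p a > 0" "r a > 0" using assms a by auto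
    have "ln (r a / p a) \<le> r a / p a - 1" using pr by (intro ln_le_minus_one) auto
    hence "p a * ln (r a / p a) \<le> p a * (r a / p a - 1)" using pr by (intro mult_left_mono) auto
    thus "p a * ln (r a) \<le> p a * ln (p a) + (r a - p a)"
      using pr by (simp add: ln_div algebra_simps)
  qed
  also have "\<dots> \<le> (\<Sum>a\<in>A. p a * ln (p a))"
    using assms(3) by (simp add: sum.distrib sum_subtractf)
  finally show ?thesis .
qed

text \<open>The image of the weight \<open>p\<close> under \<open>k\<close>; thus
  \<open>p a / key_mass p A k (k a)\<close> is the conditional weight of \<open>a\<close> given its
  key.\<close>

definition key_mass :: "('a \<Rightarrow> real) \<Rightarrow> 'a set \<Rightarrow> ('a \<Rightarrow> 'k) \<Rightarrow> 'k \<Rightarrow> real" where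
  "key_mass p A k z = sum p {a \<in> A. k a = z}"

definition key_pairs :: "'a set \<Rightarrow> ('a \<Rightarrow> 'k) \<Rightarrow> ('a \<times> 'a) set" where
  "key_pairs A k = {(a, b) \<in> A \<times> A. k a = k b}"

text \<open>The law of two copies of \<open>p\<close> that are conditionally independent given the value of \<open>k\<close>.\<close>
definition coupling :: "('a \<Rightarrow> real) \<Rightarrow> 'a set \<Rightarrow> ('a \<Rightarrow> 'k) \<Rightarrow> 'a \<times> 'a \<Rightarrow> real" where
  "coupling p A k = (\<lambda>(a, b). p a * p b / key_mass p A k (k a))"

lemma finite_key_pairs: "finite A \<Longrightarrow> finite (key_pairs A k)"
  unfolding key_pairs_def by (rule finite_subset[of _ "A \<times> A"]) auto

lemma key_mass_pos:
  assumes "finite A" "\<forall>a\<in>A. p a > 0" "a \<in> A"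
  shows "key_mass p A k (k a) > 0"
  unfolding key_mass_def using assms by (intro sum_pos) auto

lemma coupling_pos:
  assumes "finite A" "\<forall>a\<in>A. p a > 0" "z \<in> key_pairs A k"
  shows "coupling p A k z > 0"
  using assms key_mass_pos[of A p _ k] by (auto simp: coupling_def key_pairs_def)

text \<open>For fixed \<open>a\<close>, the weights \<open>p b\<close> of its possible partners add
  up to the key mass in the denominator. The test function \<open>h\<close> will be a logarithm, so
  that sums of logarithms over a coupling reduce to sums over \<open>A\<close>.\<close>

lemma coupling_marginal_fst:
  assumes "finite A" "\<forall>a\<in>A. p a > 0"
  shows "(\<Sum>z\<in>key_pairs A k. coupling p A k z * h (fst z)) = (\<Sum>a\<in>A. p a * h a)"
proof -
  have eq: "key_pairs A k = (SIGMA a:A. {b \<in> A. k b = k a})"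
    by (auto simp: key_pairs_def)
  have "(\<Sum>z\<in>key_pairs A k. coupling p A k z * h (fst z))
      = (\<Sum>a\<in>A. \<Sum>b\<in>{b \<in> A. k b = k a}. p a * p b / key_mass p A k (k a) * h a)"
    unfolding eq using assms(1) by (subst sum.Sigma) (auto simp: coupling_def intro!: sum.cong)
  also have "\<dots> = (\<Sum>a\<in>A. p a * h a)"
  proof (rule sum.cong[OF refl])
    fix a assume a: "a \<in> A"
    have "(\<Sum>b\<in>{b \<in> A. k b = k a}. p a * p b / key_mass p A k (k a) * h a)
        = p a * h a / key_mass p A k (k a) * (\<Sum>b\<in>{b \<in> A. k b = k a}. p b)"
      by (simp add: sum_distrib_left mult_ac)
    also have "\<dots> = p a * h a"
      using key_mass_pos[OF assms a, of k] by (simp add: key_mass_def)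
    finally show "(\<Sum>b\<in>{b \<in> A. k b = k a}. p a * p b / key_mass p A k (k a) * h a) = p a * h a" .
  qed
  finally show ?thesis .
qed

lemma coupling_marginal_snd:
  assumes "finite A" "\<forall>a\<in>A. p a > 0"
  shows "(\<Sum>z\<in>key_pairs A k. coupling p A k z * h (snd z)) = (\<Sum>a\<in>A. p a * h a)"
proof -
  have "(\<Sum>z\<in>key_pairs A k. coupling p A k z * h (snd z))
      = (\<Sum>z\<in>key_pairs A k. coupling p A k z * h (fst z))"
    by (rule sum.reindex_bij_witness[of _ prod.swap prod.swap])
       (auto simp: key_pairs_def coupling_def)
  with coupling_marginal_fst[OF assms] show ?thesis by simp
qed

lemma coupling_sum:
  assumes "finite A" "\<forall>a\<in>A. p a > 0"
  shows "sum (coupling p A k) (key_pairs A k) = sum p A"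
  using coupling_marginal_fst[OF assms, of k "\<lambda>_. 1"] by simp

text \<open>The logarithms depend on \<open>a\<close> only through \<open>k a\<close>, so both sums
  can be pushed forward to the image of \<open>A\<close> under \<open>k\<close>. There Gibbs'
  inequality compares \<open>f\<close> with the image of \<open>p\<close>.\<close>

lemma gibbs_inequality_key:
  assumes "finite A" "\<forall>a\<in>A. p a > 0"
    and "\<And>a. a \<in> A \<Longrightarrow> f (k a) > 0" "sum f (k ` A) \<le> sum p A"
  shows "(\<Sum>a\<in>A. p a * ln (f (k a))) \<le> (\<Sum>a\<in>A. p a * ln (key_mass p A k (k a)))"
proof -
  have push: "(\<Sum>a\<in>A. p a * h (k a)) = (\<Sum>z\<in>k ` A. key_mass p A k z * h z)" for h :: "_ \<Rightarrow> real"
    unfolding sum.image_gen[OF assms(1), of "\<lambda>a. p a * h (k a)" k] key_mass_def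
    by (auto simp: sum_distrib_right intro!: sum.cong)
  have "sum (key_mass p A k) (k ` A) = sum p A"
    using push[of "\<lambda>_. 1"] by simp
  thus ?thesis
    unfolding push[of "\<lambda>z. ln (f z)"] push[of "\<lambda>z. ln (key_mass p A k z)"]
    using assms key_mass_pos[OF assms(1,2)] by (intro gibbs_inequality) auto
qed

text \<open>In terms of entropy: \<open>H(a, b) = 2 H(a) - H(k a)\<close>, and \<open>H(k a)\<close> is at most the cross entropy with \<open>f\<close>.\<close>
lemma coupling_entropy:
  assumes "finite A" "\<forall>a\<in>A. p a > 0"
    and "\<And>a. a \<in> A \<Longrightarrow> f (k a) > 0" "sum f (k ` A) \<le> sum p A"
  shows "(\<Sum>z\<in>key_pairs A k. coupling p A k z * ln (coupling p A k z))
    \<le> 2 * (\<Sum>a\<in>A. p a * ln (p a)) - (\<Sum>a\<in>A. p a * ln (f (k a)))"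
proof -
  let ?c = "coupling p A k"
  have "(\<Sum>z\<in>key_pairs A k. ?c z * ln (?c z))
      = (\<Sum>z\<in>key_pairs A k. ?c z * ln (p (fst z)) + ?c z * ln (p (snd z))
           - ?c z * ln (key_mass p A k (k (fst z))))"
  proof (rule sum.cong[OF refl])
    fix z assume z: "z \<in> key_pairs A k"
    have pos: "p (fst z) > 0" "p (snd z) > 0" "key_mass p A k (k (fst z)) > 0"
      using z assms(2) key_mass_pos[OF assms(1,2)] by (auto simp: key_pairs_def)
    have "ln (?c z) = ln (p (fst z)) + ln (p (snd z)) - ln (key_mass p A k (k (fst z)))"
      using pos by (simp add: coupling_def case_prod_beta ln_div ln_mult)
    thus "?c z * ln (?c z) = ?c z * ln (p (fst z)) + ?c z * ln (p (snd z))
           - ?c z * ln (key_mass p A k (k (fst z)))"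
      by (simp only: distrib_left right_diff_distrib)
  qed
  also have "\<dots> = 2 * (\<Sum>a\<in>A. p a * ln (p a)) - (\<Sum>a\<in>A. p a * ln (key_mass p A k (k a)))"
    using coupling_marginal_fst[OF assms(1,2), of k "\<lambda>a. ln (p a)"]
      coupling_marginal_snd[OF assms(1,2), of k "\<lambda>a. ln (p a)"]
      coupling_marginal_fst[OF assms(1,2), of k "\<lambda>a. ln (key_mass p A k (k a))"]
    by (simp add: sum.distrib sum_subtractf)
  finally show ?thesis using gibbs_inequality_key[of A p f k] assms by force
qed

section \<open>Entropy inequality for lattice points\<close>

text \<open>All signs are those of negated entropies: the right side is -3 H(x, y) - H(x), and the
  left side is the negated sum of the cross entropies with \<open>f1\<close>, ...,
  \<open>f4\<close>. Arbitrary weights of mass at most 1 stand in place of the marginals, because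
  duality will insert the given functions here.\<close>

lemma katz_tao_entropy:
  fixes f1 f2 f3 f4 :: "int \<Rightarrow> real" and \<mu> :: "int \<times> int \<Rightarrow> real"
  assumes fin: "finite S" and pos: "\<forall>P\<in>S. \<mu> P > 0" and one: "sum \<mu> S = 1"
    and f_pos: "\<And>x y. (x, y) \<in> S \<Longrightarrow> f1 (x + y) > 0 \<and> f2 (y - x) > 0 \<and> f3 y > 0 \<and> f4 (x + 3 * y) > 0"
    and nonneg: "\<And>t. f1 t \<ge> 0" "\<And>t. f2 t \<ge> 0" "\<And>t. f3 t \<ge> 0" "\<And>t. f4 t \<ge> 0"
    and le1: "\<And>I. finite I \<Longrightarrow> sum f1 I \<le> 1" "\<And>I. finite I \<Longrightarrow> sum f2 I \<le> 1"
      "\<And>I. finite I \<Longrightarrow> sum f3 I \<le> 1" "\<And>I. finite I \<Longrightarrow> sum f4 I \<le> 1"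
  shows "(\<Sum>(x, y)\<in>S. \<mu> (x, y) * (2 * ln (f1 (x + y)) + 2 * ln (f2 (y - x)) + 2 * ln (f3 y) + ln (f4 (x + 3 * y))))
    \<le> (\<Sum>P\<in>S. \<mu> P * (3 * ln (\<mu> P) + ln (key_mass \<mu> S fst (fst P))))"
proof -
  define k where "k = (\<lambda>(x, y). y - x :: int)"
  define A where "A = key_pairs S k"
  define \<sigma> where "\<sigma> = coupling \<mu> S k"
  define l where "l = (\<lambda>z :: (int \<times> int) \<times> (int \<times> int). (snd (fst z), snd (snd z)))"
  define T where "T = key_pairs A l"
  define \<pi> where "\<pi> = coupling \<sigma> A l"
  have finA: "finite A" and finT: "finite T"
    unfolding A_def T_def by (auto intro!: finite_key_pairs fin)
  have \<sigma>_pos: "\<forall>z\<in>A. \<sigma> z > 0"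
    using coupling_pos[OF fin pos] unfolding \<sigma>_def A_def by blast
  have \<pi>_pos: "\<forall>z\<in>T. \<pi> z > 0"
    using coupling_pos[OF finA \<sigma>_pos] unfolding \<pi>_def T_def by blast
  have sum_\<sigma>: "sum \<sigma> A = 1"
    unfolding \<sigma>_def A_def using coupling_sum[OF fin pos] one by simp
  have sum_\<pi>: "sum \<pi> T = 1"
    unfolding \<pi>_def T_def using coupling_sum[OF finA \<sigma>_pos] sum_\<sigma> by simp
  \<comment> \<open>The marginals of \<open>\<sigma>\<close> are \<open>\<mu>\<close> and those of
    \<open>\<pi>\<close> are \<open>\<sigma>\<close>, so each of the four vertices of the random
    parallelogram has law \<open>\<mu>\<close>.\<close>
  have \<sigma>_fst: "(\<Sum>z\<in>A. \<sigma> z * h (fst z)) = (\<Sum>P\<in>S. \<mu> P * h P)" for h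
    unfolding \<sigma>_def A_def by (rule coupling_marginal_fst[OF fin pos])
  have \<sigma>_snd: "(\<Sum>z\<in>A. \<sigma> z * h (snd z)) = (\<Sum>P\<in>S. \<mu> P * h P)" for h
    unfolding \<sigma>_def A_def by (rule coupling_marginal_snd[OF fin pos])
  have \<pi>_fst: "(\<Sum>z\<in>T. \<pi> z * h (fst z)) = (\<Sum>z\<in>A. \<sigma> z * h z)" for h
    unfolding \<pi>_def T_def by (rule coupling_marginal_fst[OF finA \<sigma>_pos])
  have \<pi>_snd: "(\<Sum>z\<in>T. \<pi> z * h (snd z)) = (\<Sum>z\<in>A. \<sigma> z * h z)" for h
    unfolding \<pi>_def T_def by (rule coupling_marginal_snd[OF finA \<sigma>_pos])

  have "(\<Sum>z\<in>A. \<sigma> z * ln (\<sigma> z)) \<le> 2 * (\<Sum>P\<in>S. \<mu> P * ln (\<mu> P)) - (\<Sum>P\<in>S. \<mu> P * ln (f2 (k P)))"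
    unfolding \<sigma>_def A_def
    using f_pos le1(2)[of "k ` S"] fin one by (intro coupling_entropy pos) (auto simp: k_def)
  \<comment> \<open>Comparing the law of the key with the product of \<open>f3\<close> with itself
    bounds the joint entropy of the two heights by twice a cross entropy; this is subadditivity of
    entropy.\<close>
  moreover have "(\<Sum>z\<in>T. \<pi> z * ln (\<pi> z)) \<le> 2 * (\<Sum>z\<in>A. \<sigma> z * ln (\<sigma> z))
      - (\<Sum>z\<in>A. \<sigma> z * ln ((\<lambda>(y, y'). f3 y * f3 y') (l z)))"
    unfolding \<pi>_def T_def
  proof (rule coupling_entropy[OF finA \<sigma>_pos])
    have "sum (\<lambda>(y, y'). f3 y * f3 y') (l ` A) \<le> sum (\<lambda>(y, y'). f3 y * f3 y') (snd ` S \<times> snd ` S)"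
      using fin nonneg by (intro sum_mono2) (auto simp: l_def A_def key_pairs_def image_iff Bex_def)
    also have "\<dots> = sum f3 (snd ` S) * sum f3 (snd ` S)"
      by (simp add: sum_product sum.cartesian_product)
    also have "\<dots> \<le> 1 * 1" using le1(3)[of "snd ` S"] fin nonneg
      by (intro mult_mono sum_nonneg) auto
    finally show "sum (\<lambda>(y, y'). f3 y * f3 y') (l ` A) \<le> sum \<sigma> A" by (simp add: sum_\<sigma>)
  qed (use f_pos in \<open>auto simp: l_def A_def key_pairs_def\<close>)
  moreover have "(\<Sum>z\<in>A. \<sigma> z * ln ((\<lambda>(y, y'). f3 y * f3 y') (l z))) = 2 * (\<Sum>P\<in>S. \<mu> P * ln (f3 (snd P)))"
  proof -
    have "(\<Sum>z\<in>A. \<sigma> z * ln ((\<lambda>(y, y'). f3 y * f3 y') (l z)))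
      = (\<Sum>z\<in>A. \<sigma> z * ln (f3 (snd (fst z))) + \<sigma> z * ln (f3 (snd (snd z))))"
    proof (rule sum.cong[OF refl])
      fix z assume "z \<in> A"
      hence "f3 (snd (fst z)) > 0" "f3 (snd (snd z)) > 0"
        using f_pos by (auto simp: A_def key_pairs_def)
      thus "\<sigma> z * ln ((\<lambda>(y, y'). f3 y * f3 y') (l z))
          = \<sigma> z * ln (f3 (snd (fst z))) + \<sigma> z * ln (f3 (snd (snd z)))"
        by (simp add: l_def ln_mult distrib_left)
    qed
    thus ?thesis using \<sigma>_fst[of "\<lambda>P. ln (f3 (snd P))"] \<sigma>_snd[of "\<lambda>P. ln (f3 (snd P))"]
      by (simp add: sum.distrib)
  qed
  \<comment> \<open>An upper bound for the negated entropy of \<open>\<pi>\<close>, hence a lower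
    bound for the entropy of the parallelogram.\<close>
  ultimately have upper: "(\<Sum>z\<in>T. \<pi> z * ln (\<pi> z)) \<le> 4 * (\<Sum>P\<in>S. \<mu> P * ln (\<mu> P))
      - 2 * (\<Sum>P\<in>S. \<mu> P * ln (f2 (k P))) - 2 * (\<Sum>P\<in>S. \<mu> P * ln (f3 (snd P)))"
    by linarith

  define s where "s = (\<lambda>P :: int \<times> int. fst P + snd P)"
  define c where "c = (\<lambda>P :: int \<times> int. fst P + 3 * snd P)"
  \<comment> \<open>The comparison weight for the opposite bound: one factor for each of the three
    values \<open>s P\<close>, \<open>s Q'\<close>, \<open>c Q\<close>, times the conditional law of
    \<open>P'\<close> given its first coordinate. The conditional law produces the term H(x, y) -
    H(x).\<close>
  define \<rho> where "\<rho> = (\<lambda>((P, Q), (P', Q')). f1 (s P) * f1 (s Q') * f4 (c Q)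
     * (\<mu> P' / key_mass \<mu> S fst (fst P')))"
  have \<rho>_pos: "\<rho> z > 0" if "z \<in> T" for z
    using that f_pos pos key_mass_pos[OF fin pos, of _ fst]
    by (force simp: \<rho>_def s_def c_def T_def A_def key_pairs_def)
  have sum_\<rho>: "sum \<rho> T \<le> 1"
  proof -
    \<comment> \<open>On \<open>T\<close> the vertices are P = (a, y), Q = (a + d, y + d), P' = (a',
      y), Q' = (a' + d, y + d). Hence \<open>s P + 2 * s Q' - c Q\<close> equals 2 a', which is the
      constraint in \<open>V\<close>.\<close>
    define V where "V = (SIGMA w : s ` S \<times> s ` S \<times> c ` S. {P \<in> S. 2 * fst P = fst w + 2 * fst (snd w) - snd (snd w)})"
    define \<tau> where "\<tau> = (\<lambda>(w, P). f1 (fst w) * f1 (fst (snd w)) * f4 (snd (snd w))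
       * (\<mu> P / key_mass \<mu> S fst (fst P)))"
    define \<Phi> where "\<Phi> = (\<lambda>((P, Q), (P', Q')). ((s P, s Q', c Q), P' :: int \<times> int))"
    \<comment> \<open>In these coordinates \<open>P'\<close> gives a' and y, then \<open>s P\<close>
      gives a and \<open>s Q'\<close> gives 2 d.\<close>
    have inj: "inj_on \<Phi> T"
      unfolding inj_on_def \<Phi>_def T_def A_def key_pairs_def l_def s_def c_def k_def by auto
    have sub: "\<Phi> ` T \<subseteq> V"
      unfolding \<Phi>_def T_def A_def V_def key_pairs_def l_def s_def c_def k_def by auto
    have finV: "finite V" unfolding V_def using fin by auto
    have "sum \<rho> T = sum \<tau> (\<Phi> ` T)"
      unfolding sum.reindex[OF inj] by (auto simp: \<rho>_def \<tau>_def \<Phi>_def intro!: sum.cong)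
    also have "\<dots> \<le> sum \<tau> V"
    proof (rule sum_mono2[OF finV sub])
      fix v assume "v \<in> V - \<Phi> ` T"
      hence "snd v \<in> S" by (auto simp: V_def)
      hence "\<mu> (snd v) / key_mass \<mu> S fst (fst (snd v)) > 0"
        using pos key_mass_pos[OF fin pos, of "snd v" fst] by auto
      thus "\<tau> v \<ge> 0"
        using nonneg unfolding \<tau>_def case_prod_beta
        by (intro mult_nonneg_nonneg) (blast intro: less_imp_le)+
    qed
    also have "\<dots> = (\<Sum>w\<in>s ` S \<times> s ` S \<times> c ` S. f1 (fst w) * f1 (fst (snd w)) * f4 (snd (snd w)) *
        (\<Sum>P\<in>{P \<in> S. 2 * fst P = fst w + 2 * fst (snd w) - snd (snd w)}. \<mu> P / key_mass \<mu> S fst (fst P)))"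
      unfolding V_def sum_distrib_left using fin
      by (subst sum.Sigma) (auto simp: \<tau>_def intro!: sum.cong)
    also have "\<dots> \<le> (\<Sum>w\<in>s ` S \<times> s ` S \<times> c ` S. f1 (fst w) * f1 (fst (snd w)) * f4 (snd (snd w)) * 1)"
    proof (intro sum_mono mult_left_mono)
      fix w :: "int \<times> int \<times> int"
      let ?B = "{P \<in> S. 2 * fst P = fst w + 2 * fst (snd w) - snd (snd w)}"
      \<comment> \<open>The three values in \<open>w\<close> prescribe the first coordinate of
        \<open>P\<close>. So \<open>?B\<close> is empty or a full fibre of \<open>fst\<close>, on
        which the conditional law has mass 1.\<close>
      show "(\<Sum>P\<in>?B. \<mu> P / key_mass \<mu> S fst (fst P)) \<le> 1"
      proof (cases "?B = {}")
        case False
        then obtain R where R: "R \<in> ?B" by blast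
        have B: "?B = {P \<in> S. fst P = fst R}" using R by auto
        have "(\<Sum>P\<in>?B. \<mu> P / key_mass \<mu> S fst (fst P)) = (\<Sum>P\<in>?B. \<mu> P) / key_mass \<mu> S fst (fst R)"
          unfolding B sum_divide_distrib by (intro sum.cong) auto
        also have "\<dots> \<le> 1" unfolding B key_mass_def by simp
        finally show ?thesis .
      next
        case True
        show ?thesis unfolding True by simp
      qed
    qed (use nonneg in auto)
    also have "\<dots> = sum f1 (s ` S) * (sum f1 (s ` S) * sum f4 (c ` S))"
      by (simp add: sum_product sum.cartesian_product case_prod_beta mult.assoc)
    also have "\<dots> \<le> 1 * (1 * 1)"
      using le1(1)[of "s ` S"] le1(4)[of "c ` S"] fin nonneg
      by (intro mult_mono sum_nonneg mult_nonneg_nonneg) auto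
    finally show ?thesis by simp
  qed
  have ln4: "ln (a * b * c * d) = ln a + ln b + ln c + ln d"
    if "a > 0" "b > 0" "c > 0" "d > 0" for a b c d :: real
    using that by (simp add: ln_mult)
  have "(\<Sum>z\<in>T. \<pi> z * ln (\<rho> z)) \<le> (\<Sum>z\<in>T. \<pi> z * ln (\<pi> z))"
    using \<pi>_pos \<rho>_pos sum_\<rho> sum_\<pi> by (intro gibbs_inequality) auto
  moreover have "(\<Sum>z\<in>T. \<pi> z * ln (\<rho> z)) = 2 * (\<Sum>P\<in>S. \<mu> P * ln (f1 (s P)))
      + (\<Sum>P\<in>S. \<mu> P * ln (f4 (c P))) + (\<Sum>P\<in>S. \<mu> P * ln (\<mu> P / key_mass \<mu> S fst (fst P)))"
  proof -
    have "(\<Sum>z\<in>T. \<pi> z * ln (\<rho> z)) = (\<Sum>z\<in>T. \<pi> z * ln (f1 (s (fst (fst z))))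
        + \<pi> z * ln (f1 (s (snd (snd z)))) + \<pi> z * ln (f4 (c (snd (fst z))))
        + \<pi> z * ln (\<mu> (fst (snd z)) / key_mass \<mu> S fst (fst (fst (snd z)))))"
    proof (rule sum.cong[OF refl])
      fix z assume z: "z \<in> T"
      have "f1 (s (fst (fst z))) > 0" "f1 (s (snd (snd z))) > 0" "f4 (c (snd (fst z))) > 0"
        "\<mu> (fst (snd z)) / key_mass \<mu> S fst (fst (fst (snd z))) > 0"
        using z f_pos pos key_mass_pos[OF fin pos, of _ fst]
        by (force simp: s_def c_def T_def A_def key_pairs_def)+
      thus "\<pi> z * ln (\<rho> z) = \<pi> z * ln (f1 (s (fst (fst z))))
        + \<pi> z * ln (f1 (s (snd (snd z)))) + \<pi> z * ln (f4 (c (snd (fst z))))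
        + \<pi> z * ln (\<mu> (fst (snd z)) / key_mass \<mu> S fst (fst (fst (snd z))))"
        unfolding \<rho>_def case_prod_beta by (simp only: ln4 distrib_left)
    qed
    also have "\<dots> = 2 * (\<Sum>P\<in>S. \<mu> P * ln (f1 (s P)))
      + (\<Sum>P\<in>S. \<mu> P * ln (f4 (c P))) + (\<Sum>P\<in>S. \<mu> P * ln (\<mu> P / key_mass \<mu> S fst (fst P)))"
      using \<pi>_fst[of "\<lambda>z. ln (f1 (s (fst z)))"] \<sigma>_fst[of "\<lambda>P. ln (f1 (s P))"]
        \<pi>_snd[of "\<lambda>z. ln (f1 (s (snd z)))"] \<sigma>_snd[of "\<lambda>P. ln (f1 (s P))"]
        \<pi>_fst[of "\<lambda>z. ln (f4 (c (snd z)))"] \<sigma>_snd[of "\<lambda>P. ln (f4 (c P))"]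
        \<pi>_snd[of "\<lambda>z. ln (\<mu> (fst z) / key_mass \<mu> S fst (fst (fst z)))"]
        \<sigma>_fst[of "\<lambda>P. ln (\<mu> P / key_mass \<mu> S fst (fst P))"]
      by (simp only: sum.distrib)
    finally show ?thesis .
  qed
  moreover have "(\<Sum>P\<in>S. \<mu> P * ln (\<mu> P / key_mass \<mu> S fst (fst P)))
      = (\<Sum>P\<in>S. \<mu> P * ln (\<mu> P)) - (\<Sum>P\<in>S. \<mu> P * ln (key_mass \<mu> S fst (fst P)))"
    unfolding sum_subtractf[symmetric] using pos key_mass_pos[OF fin pos, of _ fst]
    by (intro sum.cong) (fastforce simp: ln_div right_diff_distrib)+
  moreover have "(\<Sum>P\<in>S. \<mu> P * (r * h P)) = r * (\<Sum>P\<in>S. \<mu> P * h P)" for r h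
    by (simp add: sum_distrib_left mult.left_commute)
  ultimately show ?thesis
    using upper
    by (simp add: case_prod_beta s_def c_def k_def distrib_left sum.distrib)
qed

section \<open>Discrete mixed norm inequality\<close>

text \<open>Here \<open>w\<close> has the exponents of the original product raised to the power 7/3,
  and 3/4 is the quotient of 7/4 and 7/3. The entropy inequality is applied to a law for which it
  becomes exactly \<open>4 * ln Z \<le> 0\<close>, where \<open>Z\<close> is the sum to be
  bounded.\<close>

lemma discrete_katz_tao_normalized:
  fixes f1 f2 f3 f4 :: "int \<Rightarrow> real"
  defines "w \<equiv> \<lambda>x y. f1 (x + y) powr (2/3) * f2 (y - x) powr (2/3) * f3 y powr (2/3) * f4 (x + 3 * y) powr (1/3)"
  assumes nonneg: "\<And>t. f1 t \<ge> 0" "\<And>t. f2 t \<ge> 0" "\<And>t. f3 t \<ge> 0" "\<And>t. f4 t \<ge> 0"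
    and le1: "\<And>I. finite I \<Longrightarrow> sum f1 I \<le> 1" "\<And>I. finite I \<Longrightarrow> sum f2 I \<le> 1"
      "\<And>I. finite I \<Longrightarrow> sum f3 I \<le> 1" "\<And>I. finite I \<Longrightarrow> sum f4 I \<le> 1"
    and fin: "finite X" "finite Y"
  shows "(\<Sum>x\<in>X. (\<Sum>y\<in>Y. w x y) powr (3/4)) \<le> 1"
proof -
  define G where "G x = (\<Sum>y\<in>Y. w x y)" for x
  define Z where "Z = (\<Sum>x\<in>X. G x powr (3/4))"
  have w_nonneg: "w x y \<ge> 0" for x y unfolding w_def by simp
  have w_pos_iff: "w x y > 0 \<longleftrightarrow> w x y \<noteq> 0" for x y using w_nonneg[of x y] by linarith
  have G_nonneg: "G x \<ge> 0" for x unfolding G_def by (intro sum_nonneg w_nonneg)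
  have "Z \<ge> 0" unfolding Z_def by (intro sum_nonneg) simp
  show ?thesis
  proof (cases "Z = 0")
    case True
    thus ?thesis by (simp add: Z_def G_def)
  next
    case False
    hence Z: "Z > 0" using \<open>Z \<ge> 0\<close> by simp
    define S where "S = {(x, y) \<in> X \<times> Y. w x y > 0}"
    \<comment> \<open>The extremal density: given x, the point y is chosen proportionally to
      \<open>w x y\<close>, and x itself has weight \<open>G x powr (3/4) / Z\<close>.\<close>
    define \<mu> where "\<mu> = (\<lambda>(x, y). w x y * G x powr (-1/4) / Z)"
    have finS: "finite S" unfolding S_def by (rule finite_subset[of _ "X \<times> Y"]) (auto simp: fin)
    have G_pos: "G x > 0" if "(x, y) \<in> S" for x y
    proof -
      have "w x y \<le> G x"
        unfolding G_def using that fin w_nonneg by (intro member_le_sum) (auto simp: S_def)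
      thus ?thesis using that by (auto simp: S_def)
    qed
    have \<mu>_pos: "\<forall>P\<in>S. \<mu> P > 0"
      using G_pos Z by (fastforce simp: \<mu>_def S_def)
    have f_pos: "f1 (x + y) > 0 \<and> f2 (y - x) > 0 \<and> f3 y > 0 \<and> f4 (x + 3 * y) > 0"
      if "(x, y) \<in> S" for x y
    proof -
      have "w x y \<noteq> 0" using that by (auto simp: S_def)
      thus ?thesis unfolding w_def using nonneg by (auto simp: less_le)
    qed
    have fibre: "(\<Sum>P\<in>{P \<in> S. fst P = x}. \<mu> P) = G x powr (3/4) / Z" if "x \<in> X" for x
    proof -
      have "(\<Sum>P\<in>{P \<in> S. fst P = x}. \<mu> P) = (\<Sum>P\<in>{x} \<times> Y. \<mu> P)"
        using that fin w_nonneg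
        by (intro sum.mono_neutral_left) (auto simp: S_def \<mu>_def w_pos_iff)
      also have "\<dots> = (\<Sum>y\<in>Y. w x y * G x powr (-1/4) / Z)"
        by (simp add: sum.cartesian_product[symmetric] \<mu>_def)
      also have "\<dots> = G x * G x powr (-1/4) / Z"
        by (simp add: G_def sum_distrib_right sum_divide_distrib)
      also have "G x * G x powr (-1/4) = G x powr (3/4)"
        using powr_mult_base[OF G_nonneg, of x "-1/4"] by simp
      finally show ?thesis .
    qed
    have sum_\<mu>: "sum \<mu> S = 1"
    proof -
      have "sum \<mu> S = (\<Sum>x\<in>X. sum \<mu> {P \<in> S. fst P = x})"
        using finS fin by (intro sum.group[symmetric]) (auto simp: S_def)
      also have "\<dots> = (\<Sum>x\<in>X. G x powr (3/4) / Z)"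
        using fibre by (intro sum.cong) auto
      also have "\<dots> = Z / Z"
        by (simp only: Z_def sum_divide_distrib)
      finally show ?thesis using Z by simp
    qed
    have "(\<Sum>(x, y)\<in>S. \<mu> (x, y) * (2 * ln (f1 (x + y)) + 2 * ln (f2 (y - x)) + 2 * ln (f3 y) + ln (f4 (x + 3 * y))))
      \<le> (\<Sum>P\<in>S. \<mu> P * (3 * ln (\<mu> P) + ln (key_mass \<mu> S fst (fst P))))"
      by (rule katz_tao_entropy[OF finS \<mu>_pos sum_\<mu> f_pos nonneg le1])
    also have "\<dots> = (\<Sum>(x, y)\<in>S. \<mu> (x, y) * (2 * ln (f1 (x + y)) + 2 * ln (f2 (y - x)) + 2 * ln (f3 y)
        + ln (f4 (x + 3 * y))) - \<mu> (x, y) * (4 * ln Z))"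
    proof (rule sum.cong[OF refl])
      fix P assume P: "P \<in> S"
      obtain x y where xy: "P = (x, y)" by (cases P)
      have "x \<in> X" using P xy by (auto simp: S_def)
      have pos: "w x y > 0" "G x > 0" using P xy G_pos by (auto simp: S_def)
      have "ln (key_mass \<mu> S fst x) = 3/4 * ln (G x) - ln Z"
        unfolding key_mass_def fibre[OF \<open>x \<in> X\<close>] using pos Z by (simp add: ln_div)
      moreover have "ln (\<mu> P) = ln (w x y) - 1/4 * ln (G x) - ln Z"
        unfolding \<mu>_def xy using pos Z by (simp add: ln_div ln_mult)
      moreover have "3 * ln (w x y) = 2 * ln (f1 (x + y)) + 2 * ln (f2 (y - x)) + 2 * ln (f3 y) + ln (f4 (x + 3 * y))"
        using f_pos[of x y] P xy unfolding w_def by (simp add: ln_mult)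
      \<comment> \<open>The powers of \<open>G x\<close> are balanced: -3/4 from the three copies of
        \<open>ln (\<mu> P)\<close> cancels 3/4 from the first marginal, leaving only
        \<open>4 * ln Z\<close>.\<close>
      ultimately have "3 * ln (\<mu> P) + ln (key_mass \<mu> S fst x) = 2 * ln (f1 (x + y)) + 2 * ln (f2 (y - x))
          + 2 * ln (f3 y) + ln (f4 (x + 3 * y)) - 4 * ln Z" by linarith
      thus "\<mu> P * (3 * ln (\<mu> P) + ln (key_mass \<mu> S fst (fst P))) =
        (case P of (x, y) \<Rightarrow> \<mu> (x, y) * (2 * ln (f1 (x + y)) + 2 * ln (f2 (y - x)) + 2 * ln (f3 y)
        + ln (f4 (x + 3 * y))) - \<mu> (x, y) * (4 * ln Z))"
        by (simp only: xy prod.case fst_conv right_diff_distrib)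
    qed
    also have "\<dots> = (\<Sum>(x, y)\<in>S. \<mu> (x, y) * (2 * ln (f1 (x + y)) + 2 * ln (f2 (y - x)) + 2 * ln (f3 y)
        + ln (f4 (x + 3 * y)))) - (\<Sum>P\<in>S. \<mu> P) * (4 * ln Z)"
      unfolding sum_distrib_right sum_subtractf[symmetric] by (rule sum.cong[OF refl]) auto
    finally have "ln Z \<le> 0" by (simp add: sum_\<mu>)
    hence "Z \<le> 1" using Z by (simp add: ln_le_zero_iff)
    thus ?thesis by (simp add: Z_def G_def)
  qed
qed

text \<open>Divide each function by its mass bound. The left side is homogeneous of degree 1/2 in
  \<open>f1\<close>, \<open>f2\<close>, \<open>f3\<close> and of degree 1/4 in
  \<open>f4\<close>.\<close>

lemma discrete_katz_tao:
  fixes f1 f2 f3 f4 :: "int \<Rightarrow> real"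
  assumes nonneg: "\<And>t. f1 t \<ge> 0" "\<And>t. f2 t \<ge> 0" "\<And>t. f3 t \<ge> 0" "\<And>t. f4 t \<ge> 0"
    and pos: "A1 > 0" "A2 > 0" "A3 > 0" "A4 > 0"
    and le: "\<And>I. finite I \<Longrightarrow> sum f1 I \<le> A1" "\<And>I. finite I \<Longrightarrow> sum f2 I \<le> A2"
      "\<And>I. finite I \<Longrightarrow> sum f3 I \<le> A3" "\<And>I. finite I \<Longrightarrow> sum f4 I \<le> A4"
    and fin: "finite X" "finite Y"
  shows "(\<Sum>x\<in>X. (\<Sum>y\<in>Y. f1 (x + y) powr (2/3) * f2 (y - x) powr (2/3) * f3 y powr (2/3)
      * f4 (x + 3 * y) powr (1/3)) powr (3/4))
    \<le> A1 powr (1/2) * A2 powr (1/2) * A3 powr (1/2) * A4 powr (1/4)"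
    (is "(\<Sum>x\<in>X. (\<Sum>y\<in>Y. ?w x y) powr (3/4)) \<le> ?A")
proof -
  define B where "B = A1 powr (2/3) * A2 powr (2/3) * A3 powr (2/3) * A4 powr (1/3)"
  have B: "B powr (3/4) = ?A" by (simp add: B_def powr_mult powr_powr)
  have "(\<Sum>x\<in>X. (\<Sum>y\<in>Y. (f1 (x + y) / A1) powr (2/3) * (f2 (y - x) / A2) powr (2/3)
      * (f3 y / A3) powr (2/3) * (f4 (x + 3 * y) / A4) powr (1/3)) powr (3/4)) \<le> 1"
    using assms by (intro discrete_katz_tao_normalized) (simp_all flip: sum_divide_distrib)
  also have "(\<Sum>x\<in>X. (\<Sum>y\<in>Y. (f1 (x + y) / A1) powr (2/3) * (f2 (y - x) / A2) powr (2/3)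
      * (f3 y / A3) powr (2/3) * (f4 (x + 3 * y) / A4) powr (1/3)) powr (3/4))
    = (\<Sum>x\<in>X. (\<Sum>y\<in>Y. ?w x y / B) powr (3/4))"
    using nonneg pos by (simp add: powr_divide B_def)
  also have "\<dots> = (\<Sum>x\<in>X. (\<Sum>y\<in>Y. ?w x y) powr (3/4)) / ?A"
    using pos by (simp add: sum_nonneg powr_divide B_def sum_divide_distrib[symmetric] flip: B)
  finally show ?thesis using pos by (simp add: divide_le_eq)
qed

section \<open>Majorization by step functions on a grid\<close>

lemma floor_eq_iff_cell:
  fixes t :: real
  assumes "N > 0"
  shows "\<lfloor>N * t\<rfloor> = j \<longleftrightarrow> t \<in> {of_int j / N..<(of_int j + 1) / N}"
  using assms by (auto simp: floor_eq_iff field_simps)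

lemma emeasure_cell:
  assumes "N > (0::real)"
  shows "emeasure lebesgue {of_int j / N..<(of_int j + 1) / N} = ennreal (1 / N)"
  using assms by (simp add: divide_simps)

lemma dyadic_bracket:
  fixes x :: real
  assumes "x > 0"
  obtains m :: int where "2 powr m < x" "x \<le> 2 powr (m + 1)"
proof
  define m where "m = \<lceil>log 2 x\<rceil> - 1"
  have "of_int m < log 2 x" "log 2 x \<le> of_int m + 1" unfolding m_def by linarith+
  thus "2 powr m < x" "x \<le> 2 powr (m + 1)"
    using assms by (simp_all add: less_log_iff log_le_iff)
qed

text \<open>The level sets \<open>{2\<^sup>m < f \<le> 2\<^sup>m\<^sup>+\<^sup>1}\<close> are covered by open sets of nearly the same measure,
  and an open set eventually contains the grid cell around each of its points.\<close>
lemma step_majorant: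
  fixes f :: "real \<Rightarrow> real"
  assumes int: "integrable lebesgue f" and nonneg: "\<And>t. f t \<ge> 0"
    and A: "A > 2 * (\<integral>t. f t \<partial>lebesgue)"
  obtains a :: "nat \<Rightarrow> int \<Rightarrow> real" where
    "\<And>n j. a n j \<ge> 0"
    "\<And>n I. finite I \<Longrightarrow> sum (a n) I \<le> A * real (Suc n)"
    "\<And>t. eventually (\<lambda>n. f t \<le> a n \<lfloor>real (Suc n) * t\<rfloor>) sequentially"
proof -
  \<comment> \<open>The slack in \<open>A\<close>, to be spent on the excess measure of the open
    covers.\<close>
  define \<epsilon> where "\<epsilon> = A - 2 * (\<integral>t. f t \<partial>lebesgue)"
  have \<epsilon>: "\<epsilon> > 0" using A by (simp add: \<epsilon>_def)
  \<comment> \<open>Enumerating the integer exponents by natural numbers lets stage \<open>n\<close>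
    use only the first \<open>n\<close> levels, so that \<open>a n j\<close> is a finite sum. The
    sets \<open>E i\<close> partition the set where \<open>f\<close> is positive.\<close>
  define e where "e = int_decode"
  define E where "E i = {t. 2 powr e i < f t \<and> f t \<le> 2 powr (e i + 1)}" for i
  \<comment> \<open>Chosen so that \<open>2 powr (e i + 1) * \<eta> i\<close> is
    \<open>\<epsilon>\<close> times a geometric weight of total sum 1.\<close>
  define \<eta> where "\<eta> i = \<epsilon> * (1/2) ^ Suc i / 2 powr (e i + 1)" for i
  have f_meas [measurable]: "f \<in> borel_measurable lebesgue" using int by auto
  have E_sets [measurable]: "E i \<in> sets lebesgue" for i
  proof -
    have "f -` {2 powr e i<..2 powr (e i + 1)} \<inter> space lebesgue \<in> sets lebesgue"
      by (rule measurable_sets[OF f_meas]) simp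
    moreover have "f -` {2 powr e i<..2 powr (e i + 1)} \<inter> space lebesgue = E i"
      by (auto simp: E_def)
    ultimately show ?thesis by simp
  qed
  have \<eta>_pos: "\<eta> i > 0" for i unfolding \<eta>_def using \<epsilon> by simp
  have "\<exists>U. open U \<and> E i \<subseteq> U \<and> emeasure lebesgue U \<le> emeasure lebesgue (E i) + ennreal (\<eta> i)" for i
  proof -
    obtain U where U: "open U" "E i \<subseteq> U" "U - E i \<in> lmeasurable" "emeasure lebesgue (U - E i) < ennreal (\<eta> i)"
      by (rule sets_lebesgue_outer_open[OF E_sets[of i] \<eta>_pos[of i]])
    have "emeasure lebesgue U = emeasure lebesgue (E i \<union> (U - E i))"
      using U(2) by (simp add: Un_absorb1)
    also have "\<dots> \<le> emeasure lebesgue (E i) + emeasure lebesgue (U - E i)"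
      using U(3) by (intro emeasure_subadditive) auto
    also have "\<dots> \<le> emeasure lebesgue (E i) + ennreal (\<eta> i)"
      using U(4) by (intro add_left_mono) auto
    finally show ?thesis using U by blast
  qed
  then obtain U where U: "\<And>i. open (U i)" "\<And>i. E i \<subseteq> U i"
      "\<And>i. emeasure lebesgue (U i) \<le> emeasure lebesgue (E i) + ennreal (\<eta> i)" by metis
  define cell where "cell n j = {of_int j / real (Suc n)..<(of_int j + 1) / real (Suc n)}" for n and j :: int
  have cell_sets: "cell n j \<in> sets lebesgue" for n j by (simp add: cell_def)
  \<comment> \<open>A level counts only on cells lying wholly inside its open set. This allows the
    number of such cells to be bounded by measure, yet near any fixed point it loses nothing once
    the mesh is small.\<close>
  define a where "a n j = (\<Sum>i<n. 2 powr (e i + 1) * of_bool (cell n j \<subseteq> U i))" for n j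
  show ?thesis
  proof
    show a_nonneg: "a n j \<ge> 0" for n j unfolding a_def by (intro sum_nonneg) auto
    have E_unique: "i = i'" if "t \<in> E i" "t \<in> E i'" for t i i'
    proof -
      have False if "e j < e j'" "t \<in> E j" "t \<in> E j'" for j j'
      proof -
        have "2 powr (real_of_int (e j) + 1) \<le> 2 powr (real_of_int (e j'))"
          using that(1) by (intro powr_mono) linarith+
        thus False using that(2,3) unfolding E_def by (simp del: powr_le_cancel_iff)
      qed
      hence "e i = e i'" using \<open>t \<in> E i\<close> \<open>t \<in> E i'\<close> by (meson linorder_neqE)
      thus ?thesis by (simp add: e_def int_decode_eq)
    qed
    \<comment> \<open>At most one level contains \<open>t\<close>, and there
      \<open>2 powr (e i) < f t\<close>; rounding up to the next power of 2 causes the factor 2 in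
      the mass bound.\<close>
    have level: "(\<Sum>i<n. ennreal (2 powr (e i + 1)) * indicator (E i) t) \<le> ennreal (2 * f t)" for n t
    proof (cases "\<exists>i<n. t \<in> E i")
      case True
      then obtain i where i: "i < n" "t \<in> E i" by blast
      have "(\<Sum>i<n. ennreal (2 powr (e i + 1)) * indicator (E i) t)
          = (\<Sum>i'<n. if i' = i then ennreal (2 powr (e i + 1)) else 0)"
        using i(2) E_unique by (intro sum.cong) (auto simp: indicator_def)
      also have "\<dots> = ennreal (2 powr (e i + 1))" using i(1) by simp
      also have "\<dots> \<le> ennreal (2 * f t)"
        using i(2) by (intro ennreal_leI) (simp add: E_def powr_add)
      finally show ?thesis .
    next
      case False
      hence "(\<Sum>i<n. ennreal (2 powr (e i + 1)) * indicator (E i) t) = 0"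
        by (intro sum.neutral) (auto simp: indicator_def)
      thus ?thesis by simp
    qed
    show "sum (a n) I \<le> A * real (Suc n)" if I: "finite I" for n I
    proof -
      define J where "J i = {j \<in> I. cell n j \<subseteq> U i}" for i
      have finJ: "finite (J i)" for i using I by (simp add: J_def)
      \<comment> \<open>The cells counted in \<open>J i\<close> are disjoint subsets of
        \<open>U i\<close>, each of measure \<open>1 / real (Suc n)\<close>.\<close>
      have card: "ennreal (card (J i) / real (Suc n)) \<le> emeasure lebesgue (E i) + ennreal (\<eta> i)" for i
      proof -
        have "j = \<lfloor>real (Suc n) * t\<rfloor>" if "t \<in> cell n j" for t j
          using that floor_eq_iff_cell[of "real (Suc n)" t j] unfolding cell_def by force
        hence disj: "disjoint_family_on (cell n) (J i)"
          unfolding disjoint_family_on_def by (metis disjoint_iff)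
        have "ennreal (card (J i) / real (Suc n)) = (\<Sum>j\<in>J i. ennreal (1 / real (Suc n)))"
          by (simp add: ennreal_of_nat_eq_real_of_nat ennreal_mult''[symmetric] del: of_nat_Suc)
        also have "\<dots> = (\<Sum>j\<in>J i. emeasure lebesgue (cell n j))"
          unfolding cell_def by (intro sum.cong refl emeasure_cell[symmetric]) simp
        also have "\<dots> = emeasure lebesgue (\<Union>j\<in>J i. cell n j)"
          using finJ disj cell_sets by (intro sum_emeasure) auto
        also have "\<dots> \<le> emeasure lebesgue (U i)"
          using U(1) by (intro emeasure_mono) (auto simp: J_def borel_open)
        finally show ?thesis using U(3)[of i] by (rule order_trans)
      qed
      have "sum (a n) I = (\<Sum>i<n. 2 powr (e i + 1) * real (card (J i)))"
        unfolding a_def J_def using I by (subst sum.swap) (simp add: sum_distrib_left[symmetric] Int_def)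
      hence "ennreal (sum (a n) I / real (Suc n))
          = (\<Sum>i<n. ennreal (2 powr (e i + 1)) * ennreal (card (J i) / real (Suc n)))"
        by (simp add: sum_divide_distrib sum_ennreal ennreal_mult''[symmetric] del: of_nat_Suc)
      also have "\<dots> \<le> (\<Sum>i<n. ennreal (2 powr (e i + 1)) * (emeasure lebesgue (E i) + ennreal (\<eta> i)))"
        by (intro sum_mono mult_left_mono card) auto
      also have "\<dots> = (\<Sum>i<n. ennreal (2 powr (e i + 1)) * emeasure lebesgue (E i))
          + (\<Sum>i<n. ennreal (\<epsilon> * (1/2) ^ Suc i))"
        using \<epsilon> by (simp add: distrib_left sum.distrib \<eta>_def ennreal_mult''[symmetric])
      also have "(\<Sum>i<n. ennreal (2 powr (e i + 1)) * emeasure lebesgue (E i))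
          = (\<integral>\<^sup>+t. (\<Sum>i<n. ennreal (2 powr (e i + 1)) * indicator (E i) t) \<partial>lebesgue)"
        by (subst nn_integral_sum) (auto simp: nn_integral_cmult_indicator)
      also have "\<dots> \<le> (\<integral>\<^sup>+t. ennreal (2 * f t) \<partial>lebesgue)"
        by (intro nn_integral_mono level)
      also have "\<dots> = ennreal (2 * (\<integral>t. f t \<partial>lebesgue))"
        using int nonneg by (subst nn_integral_eq_integral) auto
      also have "(\<Sum>i<n. ennreal (\<epsilon> * (1/2) ^ Suc i)) = ennreal (\<epsilon> * (\<Sum>i<n. (1/2) ^ Suc i))"
        using \<epsilon> by (simp add: sum_distrib_left)
      also have "\<dots> \<le> ennreal \<epsilon>"
      proof (intro ennreal_leI)
        have "(\<Sum>i<n. (1/2) ^ Suc i) = 1 - (1/2::real) ^ n" by (induction n) auto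
        hence "(\<Sum>i<n. (1/2) ^ Suc i) \<le> (1::real)" by simp
        thus "\<epsilon> * (\<Sum>i<n. (1/2) ^ Suc i) \<le> \<epsilon>" using \<epsilon> by (simp only: mult_left_le less_imp_le)
      qed
      also have "ennreal (2 * (\<integral>t. f t \<partial>lebesgue)) + ennreal \<epsilon> = ennreal A"
        using \<epsilon> nonneg by (subst ennreal_plus[symmetric]) (auto simp: \<epsilon>_def)
      finally have "ennreal (sum (a n) I / real (Suc n)) \<le> ennreal A" by (simp add: add_mono)
      moreover have "A \<ge> 0" using A Bochner_Integration.integral_nonneg[of lebesgue f, OF nonneg] by linarith
      ultimately have "sum (a n) I / real (Suc n) \<le> A" by (simp add: ennreal_le_iff)
      thus ?thesis by (simp add: divide_le_eq del: of_nat_Suc)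
    qed
    show "eventually (\<lambda>n. f t \<le> a n \<lfloor>real (Suc n) * t\<rfloor>) sequentially" for t
    proof (cases "f t = 0")
      case True
      thus ?thesis using a_nonneg by simp
    next
      case False
      then obtain m :: int where m: "2 powr m < f t" "f t \<le> 2 powr (m + 1)"
        using dyadic_bracket[of "f t"] nonneg[of t] by force
      define i where "i = int_encode m"
      have e_i: "e i = m" by (simp add: e_def i_def)
      have "t \<in> U i" using U(2)[of i] m by (auto simp: E_def e_i)
      then obtain r where r: "r > 0" "ball t r \<subseteq> U i" using U(1) openE by blast
      have "eventually (\<lambda>n. inverse (real (Suc n)) < r) sequentially"
        using order_tendstoD(2)[OF LIMSEQ_inverse_real_of_nat r(1)] .
      \<comment> \<open>Once \<open>n > i\<close>, level \<open>i\<close> is included in the sum;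
        once the mesh is below \<open>r\<close>, the cell of \<open>t\<close> lies in the
        ball.\<close>
      with eventually_gt_at_top[of i] show ?thesis
      proof eventually_elim
        case (elim n)
        have t: "t \<in> cell n \<lfloor>real (Suc n) * t\<rfloor>"
          unfolding cell_def by (subst floor_eq_iff_cell[symmetric]) auto
        have "cell n \<lfloor>real (Suc n) * t\<rfloor> \<subseteq> ball t r"
        proof
          fix s assume "s \<in> cell n \<lfloor>real (Suc n) * t\<rfloor>"
          with t have "\<bar>s - t\<bar> < inverse (real (Suc n))"
            unfolding cell_def by (auto simp: add_divide_distrib inverse_eq_divide simp del: of_nat_Suc)
          thus "s \<in> ball t r" using elim(2) by (simp add: dist_real_def)
        qed
        hence "cell n \<lfloor>real (Suc n) * t\<rfloor> \<subseteq> U i" using r(2) by blast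
        hence "2 powr (e i + 1) = 2 powr (e i + 1) * of_bool (cell n \<lfloor>real (Suc n) * t\<rfloor> \<subseteq> U i)" by simp
        also have "\<dots> \<le> a n \<lfloor>real (Suc n) * t\<rfloor>"
          unfolding a_def using elim(1) by (intro member_le_sum[where i = i]) auto
        finally show ?case using m e_i by simp
      qed
    qed
  qed
qed

section \<open>Powers and lower limits of extended nonnegative reals\<close>

lemma ennpowr_ennreal: "x \<ge> 0 \<Longrightarrow> ennpowr (ennreal x) p = ennreal (x powr p)"
  by (simp add: ennpowr_def)

lemma ennpowr_mono:
  assumes "s \<le> t" "p > 0"
  shows "ennpowr s p \<le> ennpowr t p"
proof (cases t)
  case (real x)
  with assms obtain y where "s = ennreal y" "0 \<le> y" "y \<le> x"
    by (cases s) (auto simp: top_unique)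
  with real assms show ?thesis by (simp add: ennpowr_ennreal ennreal_leI powr_mono2)
qed (simp add: ennpowr_def)

lemma less_ennpowr_iff:
  assumes "c \<ge> 0" "p > 0"
  shows "ennreal c < ennpowr t p \<longleftrightarrow> ennreal (c powr (1 / p)) < t"
proof (cases t)
  case (real x)
  have "c < x powr p \<longleftrightarrow> c powr (1 / p) < x"
  proof
    assume "c < x powr p"
    hence "c powr (1 / p) < (x powr p) powr (1 / p)" using assms by (intro powr_less_mono2) auto
    thus "c powr (1 / p) < x" using assms real by (simp add: powr_powr)
  next
    assume "c powr (1 / p) < x"
    hence "(c powr (1 / p)) powr p < x powr p" using assms by (intro powr_less_mono2) auto
    thus "c < x powr p" using assms by (simp add: powr_powr)
  qed
  with real assms show ?thesis by (simp add: ennpowr_ennreal ennreal_less_iff)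
qed (simp add: ennpowr_def)

text \<open>Lower semicontinuity of the power map. It suffices to test values strictly below the
  left side; these are finite, so \<open>less_ennpowr_iff\<close> moves them through the power in
  both directions.\<close>

lemma ennpowr_liminf_le:
  assumes "p > 0"
  shows "ennpowr (liminf u) p \<le> liminf (\<lambda>n. ennpowr (u n) p)"
  unfolding le_Liminf_iff
proof (intro allI impI)
  fix y assume y: "y < ennpowr (liminf u) p"
  then obtain c where c: "y = ennreal c" "c \<ge> 0" by (cases y) auto
  hence "ennreal (c powr (1 / p)) < liminf u" using y assms by (simp add: less_ennpowr_iff)
  hence "eventually (\<lambda>n. ennreal (c powr (1 / p)) < u n) sequentially" by (rule less_LiminfD)
  thus "eventually (\<lambda>n. y < ennpowr (u n) p) sequentially"
    using assms c by (simp add: less_ennpowr_iff)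
qed

section \<open>Step functions and floors\<close>

lemma measurable_floor_lebesgue: "(\<lambda>t::real. \<phi> \<lfloor>N * t\<rfloor>) \<in> borel_measurable lebesgue"
  by (intro measurable_completion) measurable

lemma nn_integral_floor:
  fixes \<phi> :: "int \<Rightarrow> ennreal"
  assumes "N > (0::real)" "finite K"
  shows "(\<integral>\<^sup>+t. (if \<lfloor>N * t\<rfloor> \<in> K then \<phi> \<lfloor>N * t\<rfloor> else 0) \<partial>lebesgue) = (\<Sum>k\<in>K. \<phi> k * ennreal (1 / N))"
proof -
  have meas: "(\<lambda>t. \<phi> k * indicator {of_int k / N..<(of_int k + 1) / N} t) \<in> borel_measurable lebesgue" for k
    by (intro measurable_completion) measurable
  have "(\<integral>\<^sup>+t. (if \<lfloor>N * t\<rfloor> \<in> K then \<phi> \<lfloor>N * t\<rfloor> else 0) \<partial>lebesgue)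
      = (\<integral>\<^sup>+t. (\<Sum>k\<in>K. \<phi> k * indicator {of_int k / N..<(of_int k + 1) / N} t) \<partial>lebesgue)"
  proof (rule nn_integral_cong)
    fix t
    have "(\<Sum>k\<in>K. \<phi> k * indicator {of_int k / N..<(of_int k + 1) / N} t)
        = (\<Sum>k\<in>K. if \<lfloor>N * t\<rfloor> = k then \<phi> k else 0)"
      unfolding indicator_def floor_eq_iff_cell[OF assms(1), symmetric] by (intro sum.cong) auto
    thus "(if \<lfloor>N * t\<rfloor> \<in> K then \<phi> \<lfloor>N * t\<rfloor> else 0)
        = (\<Sum>k\<in>K. \<phi> k * indicator {of_int k / N..<(of_int k + 1) / N} t)"
      using assms(2) by simp
  qed
  also have "\<dots> = (\<Sum>k\<in>K. \<phi> k * ennreal (1 / N))"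
    using emeasure_cell[OF assms(1)]
    by (subst nn_integral_sum[OF meas])
       (simp add: nn_integral_cmult_indicator del: nn_integral_completion emeasure_completion)
  finally show ?thesis .
qed

lemma sum_shift_le:
  fixes a :: "int \<Rightarrow> real"
  assumes "\<And>I. finite I \<Longrightarrow> sum a I \<le> A" "finite I"
  shows "(\<Sum>m\<in>I. a (m + d)) \<le> A"
proof -
  have "(\<Sum>m\<in>I. a (m + d)) = sum a ((\<lambda>m. m + d) ` I)"
    by (subst sum.reindex) (auto simp: inj_on_def)
  also have "\<dots> \<le> A" using assms by blast
  finally show ?thesis .
qed

text \<open>With \<open>j\<close> and \<open>k\<close> the cell indices of x and y, each sum in
  \<open>w\<close> runs over all cells that can contain the corresponding linear combination of x
  and y. The 2, 2, 1 and 4 possible cells enlarge the mass bounds by these factors.\<close>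

lemma katz_tao_step_functions:
  fixes a1 a2 a3 a4 :: "int \<Rightarrow> real" and N :: real
  defines "w \<equiv> \<lambda>j k. (a1 (j + k) + a1 (j + k + 1)) powr (2/3) * (a2 (k - j) + a2 (k - j - 1)) powr (2/3)
     * a3 k powr (2/3) * (\<Sum>d\<in>{0..3}. a4 (j + 3 * k + d)) powr (1/3)"
  assumes nonneg: "\<And>t. a1 t \<ge> 0" "\<And>t. a2 t \<ge> 0" "\<And>t. a3 t \<ge> 0" "\<And>t. a4 t \<ge> 0"
    and pos: "A1 > 0" "A2 > 0" "A3 > 0" "A4 > 0" "N > 0"
    and le: "\<And>I. finite I \<Longrightarrow> sum a1 I \<le> A1 * N" "\<And>I. finite I \<Longrightarrow> sum a2 I \<le> A2 * N"
      "\<And>I. finite I \<Longrightarrow> sum a3 I \<le> A3 * N" "\<And>I. finite I \<Longrightarrow> sum a4 I \<le> A4 * N"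
    and fin: "finite K"
  shows "(\<Sum>j\<in>K. ((\<Sum>k\<in>K. w j k) / N) powr (3/4) / N)
    \<le> (2 * A1) powr (1/2) * (2 * A2) powr (1/2) * A3 powr (1/2) * (4 * A4) powr (1/4)"
proof -
  let ?D = "(2 * A1) powr (1/2) * (2 * A2) powr (1/2) * A3 powr (1/2) * (4 * A4) powr (1/4)"
  define b1 where "b1 m = a1 m + a1 (m + 1)" for m
  define b2 where "b2 m = a2 m + a2 (m - 1)" for m
  define b4 where "b4 m = (\<Sum>d\<in>{0..3}. a4 (m + d))" for m
  have "(\<Sum>j\<in>K. (\<Sum>k\<in>K. b1 (j + k) powr (2/3) * b2 (k - j) powr (2/3)
      * a3 k powr (2/3) * b4 (j + 3 * k) powr (1/3)) powr (3/4))
    \<le> (2 * A1 * N) powr (1/2) * (2 * A2 * N) powr (1/2) * (A3 * N) powr (1/2) * (4 * A4 * N) powr (1/4)"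
  proof (rule discrete_katz_tao)
    fix I :: "int set" assume I: "finite I"
    show "sum b1 I \<le> 2 * A1 * N"
      using sum_shift_le[OF le(1) I, of 0] sum_shift_le[OF le(1) I, of 1]
      by (simp add: b1_def sum.distrib)
    show "sum b2 I \<le> 2 * A2 * N"
      using sum_shift_le[OF le(2) I, of 0] sum_shift_le[OF le(2) I, of "-1"]
      by (simp add: b2_def sum.distrib)
    show "sum a3 I \<le> A3 * N" using le(3) I .
    have "sum b4 I = (\<Sum>d\<in>{0..3}. \<Sum>m\<in>I. a4 (m + d))" unfolding b4_def by (rule sum.swap)
    also have "\<dots> \<le> (\<Sum>d\<in>{0..3::int}. A4 * N)" using le(4) I by (intro sum_mono sum_shift_le)
    finally show "sum b4 I \<le> 4 * A4 * N" by simp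
  qed (use nonneg pos fin in \<open>auto simp: b1_def b2_def b4_def intro!: sum_nonneg\<close>)
  also have "\<dots> = ?D * (N powr (1/2) * N powr (1/2) * N powr (1/2) * N powr (1/4))"
    by (simp add: powr_mult)
  \<comment> \<open>The scaling is critical: the masses contribute \<open>N\<close> to the power 1/2
    + 1/2 + 1/2 + 1/4 = 7/4, exactly what the cell lengths 1/N remove in the inner (3/4) and outer
    (1) integration.\<close>
  also have "\<dots> = ?D * (N powr (3/4) * N)"
  proof -
    have "N powr (1/2) * N powr (1/2) = N" "N powr (3/4) = N powr (1/2) * N powr (1/4)"
      using pos by (simp_all flip: powr_add)
    thus ?thesis by (simp only: mult_ac)
  qed
  finally have "(\<Sum>j\<in>K. (\<Sum>k\<in>K. w j k) powr (3/4)) \<le> ?D * (N powr (3/4) * N)"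
    by (simp add: w_def b1_def b2_def b4_def)
  moreover have "(\<Sum>j\<in>K. ((\<Sum>k\<in>K. w j k) / N) powr (3/4) / N)
      = (\<Sum>j\<in>K. (\<Sum>k\<in>K. w j k) powr (3/4)) / (N powr (3/4) * N)"
  proof -
    have "(\<Sum>k\<in>K. w j k) \<ge> 0" for j by (simp add: w_def sum_nonneg)
    thus ?thesis
      unfolding sum_divide_distrib[of "\<lambda>j. (\<Sum>k\<in>K. w j k) powr (3/4)"]
      using pos by (intro sum.cong) (simp_all add: powr_divide)
  qed
  ultimately show ?thesis using pos by (simp add: divide_le_eq)
qed

text \<open>For fractional parts p of \<open>u\<close> and q of \<open>v\<close>, the sum p + q lies
  in [0, 2), the difference q - p in (-1, 1), and p + 3 q in [0, 4).\<close>

lemma floor_cases: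
  fixes u v :: real
  shows "\<lfloor>u + v\<rfloor> \<in> {\<lfloor>u\<rfloor> + \<lfloor>v\<rfloor>, \<lfloor>u\<rfloor> + \<lfloor>v\<rfloor> + 1}"
    and "\<lfloor>- u + v\<rfloor> \<in> {\<lfloor>v\<rfloor> - \<lfloor>u\<rfloor>, \<lfloor>v\<rfloor> - \<lfloor>u\<rfloor> - 1}"
    and "\<lfloor>u + 3 * v\<rfloor> - \<lfloor>u\<rfloor> - 3 * \<lfloor>v\<rfloor> \<in> {0..3}"
proof -
  show "\<lfloor>u + v\<rfloor> \<in> {\<lfloor>u\<rfloor> + \<lfloor>v\<rfloor>, \<lfloor>u\<rfloor> + \<lfloor>v\<rfloor> + 1}"
    "\<lfloor>- u + v\<rfloor> \<in> {\<lfloor>v\<rfloor> - \<lfloor>u\<rfloor>, \<lfloor>v\<rfloor> - \<lfloor>u\<rfloor> - 1}" by (simp; linarith)+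
  have "\<lfloor>u + 3 * v\<rfloor> - \<lfloor>u\<rfloor> - 3 * \<lfloor>v\<rfloor> \<ge> 0" "\<lfloor>u + 3 * v\<rfloor> - \<lfloor>u\<rfloor> - 3 * \<lfloor>v\<rfloor> \<le> 3" by linarith+
  thus "\<lfloor>u + 3 * v\<rfloor> - \<lfloor>u\<rfloor> - 3 * \<lfloor>v\<rfloor> \<in> {0..3}" by simp
qed

text \<open>The discrete inequality needs finitely many indices. Indices up to the square of
  \<open>Suc n\<close> cover an interval of length growing with \<open>n\<close>, hence eventually
  every point.\<close>

lemma eventually_floor_in_box:
  "eventually (\<lambda>n. \<lfloor>real (Suc n) * t\<rfloor> \<in> {- (int (Suc n) ^ 2)..int (Suc n) ^ 2}) sequentially"
proof -
  have "eventually (\<lambda>n. real n \<ge> \<bar>t\<bar>) sequentially"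
    using filterlim_at_top[THEN iffD1, OF filterlim_real_sequentially] by blast
  thus ?thesis
  proof eventually_elim
    case (elim n)
    define M where "M = real (Suc n)"
    have "\<bar>t\<bar> \<le> M - 1" "M \<ge> 1" using elim by (auto simp: M_def)
    hence "M * \<bar>t\<bar> \<le> M * (M - 1)" by (intro mult_left_mono) auto
    hence "\<bar>M * t\<bar> \<le> M ^ 2 - M" using \<open>M \<ge> 1\<close> by (simp add: abs_mult power2_eq_square algebra_simps)
    hence "- (M ^ 2) \<le> M * t - 1 + 0" "M * t \<le> M ^ 2" using \<open>M \<ge> 1\<close> by linarith+
    moreover have "M ^ 2 = real_of_int (int (Suc n) ^ 2)" by (simp add: M_def)
    ultimately have "- (int (Suc n) ^ 2) \<le> \<lfloor>M * t\<rfloor>" "\<lfloor>M * t\<rfloor> \<le> int (Suc n) ^ 2"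
      by linarith+
    thus ?case by (simp add: M_def)
  qed
qed

section \<open>Passage to the integral inequality\<close>

text \<open>The integrand is eventually dominated, at each point, by step functions satisfying the
  bound uniformly in \<open>n\<close>. Fatou's lemma is used in y and then in x, with lower
  semicontinuity of the power in between.\<close>

lemma katz_tao_mixed_integral:
  fixes f1 f2 f3 f4 :: "real \<Rightarrow> real"
  assumes int: "integrable lebesgue f1" "integrable lebesgue f2" "integrable lebesgue f3" "integrable lebesgue f4"
    and nonneg: "\<And>t. f1 t \<ge> 0" "\<And>t. f2 t \<ge> 0" "\<And>t. f3 t \<ge> 0" "\<And>t. f4 t \<ge> 0"
    and A: "A1 > 2 * (\<integral>t. f1 t \<partial>lebesgue)" "A2 > 2 * (\<integral>t. f2 t \<partial>lebesgue)"
      "A3 > 2 * (\<integral>t. f3 t \<partial>lebesgue)" "A4 > 2 * (\<integral>t. f4 t \<partial>lebesgue)"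
  shows "(\<integral>\<^sup>+x. ennpowr (\<integral>\<^sup>+y. ennreal (f1 (x + y) powr (2/3) * f2 (- x + y) powr (2/3)
      * f3 y powr (2/3) * f4 (x + 3 * y) powr (1/3)) \<partial>lebesgue) (3/4) \<partial>lebesgue)
    \<le> ennreal ((2 * A1) powr (1/2) * (2 * A2) powr (1/2) * A3 powr (1/2) * (4 * A4) powr (1/4))"
    (is "(\<integral>\<^sup>+x. ennpowr (\<integral>\<^sup>+y. ennreal (?F x y) \<partial>lebesgue) (3/4) \<partial>lebesgue) \<le> ennreal ?D")
proof -
  obtain a1 where a1: "\<And>n j. a1 n j \<ge> 0" "\<And>n I. finite I \<Longrightarrow> sum (a1 n) I \<le> A1 * real (Suc n)"
    "\<And>t. eventually (\<lambda>n. f1 t \<le> a1 n \<lfloor>real (Suc n) * t\<rfloor>) sequentially"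
    by (rule step_majorant[OF int(1) nonneg(1) A(1)]) (rule that)
  obtain a2 where a2: "\<And>n j. a2 n j \<ge> 0" "\<And>n I. finite I \<Longrightarrow> sum (a2 n) I \<le> A2 * real (Suc n)"
    "\<And>t. eventually (\<lambda>n. f2 t \<le> a2 n \<lfloor>real (Suc n) * t\<rfloor>) sequentially"
    by (rule step_majorant[OF int(2) nonneg(2) A(2)]) (rule that)
  obtain a3 where a3: "\<And>n j. a3 n j \<ge> 0" "\<And>n I. finite I \<Longrightarrow> sum (a3 n) I \<le> A3 * real (Suc n)"
    "\<And>t. eventually (\<lambda>n. f3 t \<le> a3 n \<lfloor>real (Suc n) * t\<rfloor>) sequentially"
    by (rule step_majorant[OF int(3) nonneg(3) A(3)]) (rule that)
  obtain a4 where a4: "\<And>n j. a4 n j \<ge> 0" "\<And>n I. finite I \<Longrightarrow> sum (a4 n) I \<le> A4 * real (Suc n)"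
    "\<And>t. eventually (\<lambda>n. f4 t \<le> a4 n \<lfloor>real (Suc n) * t\<rfloor>) sequentially"
    by (rule step_majorant[OF int(4) nonneg(4) A(4)]) (rule that)
  have A_pos: "A1 > 0" "A2 > 0" "A3 > 0" "A4 > 0"
    using A Bochner_Integration.integral_nonneg[of lebesgue f1, OF nonneg(1)]
      Bochner_Integration.integral_nonneg[of lebesgue f2, OF nonneg(2)]
      Bochner_Integration.integral_nonneg[of lebesgue f3, OF nonneg(3)]
      Bochner_Integration.integral_nonneg[of lebesgue f4, OF nonneg(4)] by linarith+
  define N where "N n = real (Suc n)" for n
  have N_pos: "N n > 0" for n by (simp add: N_def)
  define K where "K n = {- (int (Suc n) ^ 2)..int (Suc n) ^ 2}" for n
  define w where "w n = (\<lambda>j k. (a1 n (j + k) + a1 n (j + k + 1)) powr (2/3)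
     * (a2 n (k - j) + a2 n (k - j - 1)) powr (2/3)
     * a3 n k powr (2/3) * (\<Sum>d\<in>{0..3}. a4 n (j + 3 * k + d)) powr (1/3))" for n
  have w_nonneg: "w n j k \<ge> 0" for n j k by (simp add: w_def)
  define u where "u n x y = (if \<lfloor>N n * x\<rfloor> \<in> K n \<and> \<lfloor>N n * y\<rfloor> \<in> K n
     then ennreal (w n \<lfloor>N n * x\<rfloor> \<lfloor>N n * y\<rfloor>) else 0)" for n and x y :: real

  have majorant: "eventually (\<lambda>n. ennreal (?F x y) \<le> u n x y) sequentially" for x y
    using eventually_floor_in_box[of x] eventually_floor_in_box[of y]
      a1(3)[of "x + y"] a2(3)[of "- x + y"] a3(3)[of y] a4(3)[of "x + 3 * y"]
  proof eventually_elim
    case (elim n)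
    define j where "j = \<lfloor>N n * x\<rfloor>"
    define k where "k = \<lfloor>N n * y\<rfloor>"
    note [simp] = a1(1) a2(1) a3(1) a4(1)
    have 1: "f1 (x + y) \<le> a1 n (j + k) + a1 n (j + k + 1)"
    proof -
      have "a1 n \<lfloor>N n * (x + y)\<rfloor> \<le> a1 n (j + k) + a1 n (j + k + 1)"
        using floor_cases(1)[of "N n * x" "N n * y"] unfolding j_def k_def distrib_left by force
      thus ?thesis using elim(3) unfolding N_def by linarith
    qed
    have 2: "f2 (- x + y) \<le> a2 n (k - j) + a2 n (k - j - 1)"
    proof -
      have "N n * (- x + y) = - (N n * x) + N n * y" by (simp add: algebra_simps)
      hence "a2 n \<lfloor>N n * (- x + y)\<rfloor> \<le> a2 n (k - j) + a2 n (k - j - 1)"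
        using floor_cases(2)[of "N n * x" "N n * y"] unfolding j_def k_def by force
      thus ?thesis using elim(4) unfolding N_def by linarith
    qed
    have 3: "f3 y \<le> a3 n k" using elim(5) unfolding N_def k_def .
    have 4: "f4 (x + 3 * y) \<le> (\<Sum>d\<in>{0..3}. a4 n (j + 3 * k + d))"
    proof -
      define d where "d = \<lfloor>N n * (x + 3 * y)\<rfloor> - j - 3 * k"
      have "N n * (x + 3 * y) = N n * x + 3 * (N n * y)" by (simp add: algebra_simps)
      hence "d \<in> {0..3}" using floor_cases(3)[of "N n * x" "N n * y"] by (simp only: d_def j_def k_def)
      hence "a4 n (j + 3 * k + d) \<le> (\<Sum>d\<in>{0..3}. a4 n (j + 3 * k + d))"
        by (intro member_le_sum[where i = d]) auto
      moreover have "\<lfloor>N n * (x + 3 * y)\<rfloor> = j + 3 * k + d" by (simp add: d_def)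
      ultimately show ?thesis using elim(6) unfolding N_def by simp
    qed
    have "?F x y \<le> w n j k"
      unfolding w_def using 1 2 3 4 nonneg by (intro mult_mono powr_mono2 mult_nonneg_nonneg) auto
    thus ?case using elim(1,2) by (simp add: u_def K_def N_def j_def k_def ennreal_leI)
  qed

  have inner: "(\<integral>\<^sup>+y. u n x y \<partial>lebesgue)
      = (if \<lfloor>N n * x\<rfloor> \<in> K n then ennreal ((\<Sum>k\<in>K n. w n \<lfloor>N n * x\<rfloor> k) / N n) else 0)" for n x
  proof (cases "\<lfloor>N n * x\<rfloor> \<in> K n")
    case True
    hence "(\<integral>\<^sup>+y. u n x y \<partial>lebesgue) = (\<Sum>k\<in>K n. ennreal (w n \<lfloor>N n * x\<rfloor> k) * ennreal (1 / N n))"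
      using nn_integral_floor[OF N_pos[of n], of "K n" "\<lambda>k. ennreal (w n \<lfloor>N n * x\<rfloor> k)"]
      by (simp add: u_def K_def)
    also have "\<dots> = ennreal ((\<Sum>k\<in>K n. w n \<lfloor>N n * x\<rfloor> k) / N n)"
      using N_pos[of n] w_nonneg by (simp add: ennreal_mult''[symmetric] sum_divide_distrib)
    finally show ?thesis using True by simp
  qed (simp add: u_def)
  define v where "v n x = ennpowr (\<integral>\<^sup>+y. u n x y \<partial>lebesgue) (3/4)" for n x
  have v: "v n x = (if \<lfloor>N n * x\<rfloor> \<in> K n
      then ennreal (((\<Sum>k\<in>K n. w n \<lfloor>N n * x\<rfloor> k) / N n) powr (3/4)) else 0)" for n x
    using N_pos[of n] w_nonneg
    by (auto simp: v_def inner ennpowr_ennreal sum_nonneg less_imp_le ennpowr_def)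
  have outer: "(\<integral>\<^sup>+x. v n x \<partial>lebesgue) \<le> ennreal ?D" for n
  proof -
    have "(\<integral>\<^sup>+x. v n x \<partial>lebesgue)
        = (\<Sum>j\<in>K n. ennreal (((\<Sum>k\<in>K n. w n j k) / N n) powr (3/4)) * ennreal (1 / N n))"
      unfolding v by (rule nn_integral_floor[OF N_pos]) (simp add: K_def)
    also have "\<dots> = ennreal (\<Sum>j\<in>K n. ((\<Sum>k\<in>K n. w n j k) / N n) powr (3/4) / N n)"
      using N_pos[of n] by (simp add: ennreal_mult''[symmetric] less_imp_le)
    also have "\<dots> \<le> ennreal ?D"
      unfolding w_def using a1 a2 a3 a4 A_pos N_pos
      by (intro ennreal_leI katz_tao_step_functions) (auto simp: N_def K_def)
    finally show ?thesis .
  qed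

  \<comment> \<open>Fatou's lemma only meets functions of floors, whose measurability is immediate;
    the original integrand enters through monotonicity of the integral.\<close>
  have u_meas: "u n x \<in> borel_measurable lebesgue" for n x
    unfolding u_def by (rule measurable_floor_lebesgue)
  have v_meas: "v n \<in> borel_measurable lebesgue" for n
    unfolding v by (rule measurable_floor_lebesgue)
  have "ennpowr (\<integral>\<^sup>+y. ennreal (?F x y) \<partial>lebesgue) (3/4) \<le> liminf (\<lambda>n. v n x)" for x
  proof -
    have "(\<integral>\<^sup>+y. ennreal (?F x y) \<partial>lebesgue) \<le> (\<integral>\<^sup>+y. liminf (\<lambda>n. u n x y) \<partial>lebesgue)"
      by (intro nn_integral_mono Liminf_bounded majorant)
    also have "\<dots> \<le> liminf (\<lambda>n. \<integral>\<^sup>+y. u n x y \<partial>lebesgue)"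
      by (rule nn_integral_liminf[OF u_meas])
    finally have "ennpowr (\<integral>\<^sup>+y. ennreal (?F x y) \<partial>lebesgue) (3/4)
        \<le> ennpowr (liminf (\<lambda>n. \<integral>\<^sup>+y. u n x y \<partial>lebesgue)) (3/4)"
      by (rule ennpowr_mono) simp
    also have "\<dots> \<le> liminf (\<lambda>n. v n x)"
      unfolding v_def by (rule ennpowr_liminf_le) simp
    finally show ?thesis .
  qed
  hence "(\<integral>\<^sup>+x. ennpowr (\<integral>\<^sup>+y. ennreal (?F x y) \<partial>lebesgue) (3/4) \<partial>lebesgue)
      \<le> (\<integral>\<^sup>+x. liminf (\<lambda>n. v n x) \<partial>lebesgue)"
    by (intro nn_integral_mono)
  also have "\<dots> \<le> liminf (\<lambda>n. \<integral>\<^sup>+x. v n x \<partial>lebesgue)"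
    by (rule nn_integral_liminf[OF v_meas])
  also have "\<dots> \<le> liminf (\<lambda>n. ennreal ?D)"
    by (intro Liminf_mono always_eventually allI outer)
  also have "\<dots> = ennreal ?D" by (simp add: Liminf_const)
  finally show ?thesis .
qed

text \<open>The inner power 7/3 turns the exponents 2/7 and 1/7 into 2/3 and 1/3.\<close>

lemma mixed_norm_eq:
  fixes f1 f2 f3 f4 :: "real \<Rightarrow> real"
  shows "mixed_norm (7/4) (7/3)
        (\<lambda>(x, y). f1 (x + y) powr (2/7) * f2 (- x + y) powr (2/7)
                  * f3 y powr (2/7) * f4 (x + 3 * y) powr (1/7))
    = ennpowr (\<integral>\<^sup>+x. ennpowr (\<integral>\<^sup>+y. ennreal (f1 (x + y) powr (2/3) * f2 (- x + y) powr (2/3)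
      * f3 y powr (2/3) * f4 (x + 3 * y) powr (1/3)) \<partial>lebesgue) (3/4) \<partial>lebesgue) (4/7)"
  by (simp add: mixed_norm_def abs_mult powr_mult powr_powr)

theorem theorem1p1:
  shows "\<exists>C::real. C \<ge> 0 \<and>
    (\<forall>f1 f2 f3 f4 :: real \<Rightarrow> real.
      integrable lebesgue f1 \<longrightarrow> integrable lebesgue f2 \<longrightarrow>
      integrable lebesgue f3 \<longrightarrow> integrable lebesgue f4 \<longrightarrow>
      (\<forall>t. f1 t \<ge> 0) \<longrightarrow> (\<forall>t. f2 t \<ge> 0) \<longrightarrow> (\<forall>t. f3 t \<ge> 0) \<longrightarrow> (\<forall>t. f4 t \<ge> 0) \<longrightarrow>
      mixed_norm (7/4) (7/3)
        (\<lambda>(x, y). f1 (x + y) powr (2/7) * f2 (- x + y) powr (2/7)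
                  * f3 y powr (2/7) * f4 (x + 3 * y) powr (1/7))
      \<le> ennreal (C * L1_norm f1 powr (2/7) * L1_norm f2 powr (2/7)
                   * L1_norm f3 powr (2/7) * L1_norm f4 powr (1/7)))"
\<comment> \<open>Each base has a factor 2 from the step majorants; the numbers 2, 2, 1, 4 of
  neighbouring cells turn it into 4, 4, 2, 8.\<close>
proof (intro exI[of _ "4 powr (2/7) * 4 powr (2/7) * 2 powr (2/7) * 8 powr (1/7)"] conjI allI impI)
  fix f1 f2 f3 f4 :: "real \<Rightarrow> real"
  assume int: "integrable lebesgue f1" "integrable lebesgue f2" "integrable lebesgue f3" "integrable lebesgue f4"
    and "\<forall>t. f1 t \<ge> 0" "\<forall>t. f2 t \<ge> 0" "\<forall>t. f3 t \<ge> 0" "\<forall>t. f4 t \<ge> 0"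
  hence nonneg: "\<And>t. f1 t \<ge> 0" "\<And>t. f2 t \<ge> 0" "\<And>t. f3 t \<ge> 0" "\<And>t. f4 t \<ge> 0" by auto
  let ?M = "mixed_norm (7/4) (7/3)
        (\<lambda>(x, y). f1 (x + y) powr (2/7) * f2 (- x + y) powr (2/7)
                  * f3 y powr (2/7) * f4 (x + 3 * y) powr (1/7))"
  have L1: "(\<integral>t. f1 t \<partial>lebesgue) = L1_norm f1" "(\<integral>t. f2 t \<partial>lebesgue) = L1_norm f2"
    "(\<integral>t. f3 t \<partial>lebesgue) = L1_norm f3" "(\<integral>t. f4 t \<partial>lebesgue) = L1_norm f4"
    using nonneg by (simp_all add: L1_norm_def)
  have L1_nonneg: "L1_norm f \<ge> 0" for f by (simp add: L1_norm_def)
  \<comment> \<open>The mass bounds must strictly exceed twice the norms, so they are taken with an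
    excess \<open>\<epsilon>\<close> that then tends to 0.\<close>
  define B where "B \<epsilon> = (2 * (2 * L1_norm f1 + \<epsilon>)) powr (2/7) * (2 * (2 * L1_norm f2 + \<epsilon>)) powr (2/7)
      * (2 * L1_norm f3 + \<epsilon>) powr (2/7) * (4 * (2 * L1_norm f4 + \<epsilon>)) powr (1/7)" for \<epsilon>
  have bound: "?M \<le> ennreal (B \<epsilon>)" if "\<epsilon> > 0" for \<epsilon>
  proof -
    let ?D = "(2 * (2 * L1_norm f1 + \<epsilon>)) powr (1/2) * (2 * (2 * L1_norm f2 + \<epsilon>)) powr (1/2)
      * (2 * L1_norm f3 + \<epsilon>) powr (1/2) * (4 * (2 * L1_norm f4 + \<epsilon>)) powr (1/4)"
    have "?M \<le> ennpowr (ennreal ?D) (4/7)"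
      unfolding mixed_norm_eq using that
      by (intro ennpowr_mono katz_tao_mixed_integral int nonneg) (simp_all add: L1)
    also have "\<dots> = ennreal (B \<epsilon>)"
      by (simp add: ennpowr_ennreal B_def powr_mult powr_powr)
    finally show ?thesis .
  qed
  \<comment> \<open>A base may tend to 0, namely when a norm vanishes; the powers are still
    continuous there because the exponents are positive.\<close>
  have "(\<lambda>n. B (inverse (real (Suc n)))) \<longlonglongrightarrow> B 0"
    unfolding B_def using L1_nonneg
    by (intro tendsto_intros tendsto_powr' LIMSEQ_inverse_real_of_nat) auto
  hence "(\<lambda>n. ennreal (B (inverse (real (Suc n))))) \<longlonglongrightarrow> ennreal (B 0)"
    by (rule tendsto_ennrealI)
  hence "?M \<le> ennreal (B 0)"
    by (rule tendsto_lowerbound) (intro always_eventually allI bound, auto)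
  also have "B 0 = 4 powr (2/7) * 4 powr (2/7) * 2 powr (2/7) * 8 powr (1/7)
      * L1_norm f1 powr (2/7) * L1_norm f2 powr (2/7) * L1_norm f3 powr (2/7) * L1_norm f4 powr (1/7)"
  proof -
    have "B 0 = (4 * L1_norm f1) powr (2/7) * (4 * L1_norm f2) powr (2/7)
      * (2 * L1_norm f3) powr (2/7) * (8 * L1_norm f4) powr (1/7)"
      by (simp add: B_def)
    thus ?thesis by (simp add: powr_mult)
  qed
  finally show "?M \<le> ennreal (4 powr (2/7) * 4 powr (2/7) * 2 powr (2/7) * 8 powr (1/7)
      * L1_norm f1 powr (2/7) * L1_norm f2 powr (2/7) * L1_norm f3 powr (2/7) * L1_norm f4 powr (1/7))" .
qed simp

end
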